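(* Let $R$ be a $\ast$-ring. Then $R$ is $\ast$-reversible if and only if for all $a,b\in R$, $ab\in R^{\mathrm{EP}}$ implies $b^{\ast}a\in R^{\mathrm{EP}}$.
   Context: Rings are associative with unity. A $\ast$-ring is a ring $R$ with an involution, i.e. a map $a\mapsto a^{\ast}$ satisfying $(a^{\ast})^{\ast}=a$, $(a+b)^{\ast}=a^{\ast}+b^{\ast}$, $(ab)^{\ast}=b^{\ast}a^{\ast}$ for all $a,b\in R$. A $\ast$-ring $R$ is $\ast$-reversible if for all $a,b\in R$, $ab=0$ implies $b^{\ast}a=0$. An element $a\in R$ is group invertible if there is a (necessarily unique) $x\in R$ with $axa=a$, $xax=x$, $ax=xa$; write $x=a^{\sharp}$, and $R^{\sharp}$ for the set of group invertible elements. An element $a\in R$ is Moore-Penrose invertible if there is a (necessarily unique) $x\in R$ with $axa=a$, $xax=x$, $(ax)^{\ast}=ax$, $(xa)^{\ast}=xa$; write $x=a^{\dagger}$, and $R^{\dagger}$ for the set of Moore-Penrose invertible elements. An element $a$ is an EP element if $a\in R^{\sharp}\cap R^{\dagger}$ and $a^{\sharp}=a^{\dagger}$. $R^{\mathrm{EP}}$ is the set of all EP elements of $R$. *)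

theory Defs
  imports "HOL-Algebra.Ring"
begin

text \<open>HOL-Algebra's \<open>ring\<close> is associative and unital, and allows the zero ring.\<close>

locale star_ring = ring R for R (structure) +
  fixes star :: "'a \<Rightarrow> 'a"
  assumes star_closed: "a \<in> carrier R \<Longrightarrow> star a \<in> carrier R"
    and star_star: "a \<in> carrier R \<Longrightarrow> star (star a) = a"
    and star_add: "a \<in> carrier R \<Longrightarrow> b \<in> carrier R \<Longrightarrow> star (a \<oplus> b) = star a \<oplus> star b"
    and star_mult: "a \<in> carrier R \<Longrightarrow> b \<in> carrier R \<Longrightarrow> star (a \<otimes> b) = star b \<otimes> star a"

definition star_reversible :: "('a, 'm) ring_scheme \<Rightarrow> ('a \<Rightarrow> 'a) \<Rightarrow> bool" where
  "star_reversible R star \<longleftrightarrow>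
     (\<forall>a\<in>carrier R. \<forall>b\<in>carrier R. a \<otimes>\<^bsub>R\<^esub> b = \<zero>\<^bsub>R\<^esub> \<longrightarrow> star b \<otimes>\<^bsub>R\<^esub> a = \<zero>\<^bsub>R\<^esub>)"

definition is_group_inverse :: "('a, 'm) ring_scheme \<Rightarrow> 'a \<Rightarrow> 'a \<Rightarrow> bool" where
  "is_group_inverse R a x \<longleftrightarrow> x \<in> carrier R \<and>
     a \<otimes>\<^bsub>R\<^esub> x \<otimes>\<^bsub>R\<^esub> a = a \<and> x \<otimes>\<^bsub>R\<^esub> a \<otimes>\<^bsub>R\<^esub> x = x \<and> a \<otimes>\<^bsub>R\<^esub> x = x \<otimes>\<^bsub>R\<^esub> a"

definition is_MP_inverse :: "('a, 'm) ring_scheme \<Rightarrow> ('a \<Rightarrow> 'a) \<Rightarrow> 'a \<Rightarrow> 'a \<Rightarrow> bool" where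
  "is_MP_inverse R star a x \<longleftrightarrow> x \<in> carrier R \<and>
     a \<otimes>\<^bsub>R\<^esub> x \<otimes>\<^bsub>R\<^esub> a = a \<and> x \<otimes>\<^bsub>R\<^esub> a \<otimes>\<^bsub>R\<^esub> x = x \<and>
     star (a \<otimes>\<^bsub>R\<^esub> x) = a \<otimes>\<^bsub>R\<^esub> x \<and> star (x \<otimes>\<^bsub>R\<^esub> a) = x \<otimes>\<^bsub>R\<^esub> a"

definition group_invertibles :: "('a, 'm) ring_scheme \<Rightarrow> 'a set" where
  "group_invertibles R = {a \<in> carrier R. \<exists>x. is_group_inverse R a x}"

definition MP_invertibles :: "('a, 'm) ring_scheme \<Rightarrow> ('a \<Rightarrow> 'a) \<Rightarrow> 'a set" where
  "MP_invertibles R star = {a \<in> carrier R. \<exists>x. is_MP_inverse R star a x}"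

text \<open>The inverses below are meaningful only for invertible elements; there the description
  is well defined by the uniqueness lemmas at the end.\<close>

definition group_inverse :: "('a, 'm) ring_scheme \<Rightarrow> 'a \<Rightarrow> 'a" where
  "group_inverse R a = (THE x. is_group_inverse R a x)"

definition MP_inverse :: "('a, 'm) ring_scheme \<Rightarrow> ('a \<Rightarrow> 'a) \<Rightarrow> 'a \<Rightarrow> 'a" where
  "MP_inverse R star a = (THE x. is_MP_inverse R star a x)"

definition EP_elements :: "('a, 'm) ring_scheme \<Rightarrow> ('a \<Rightarrow> 'a) \<Rightarrow> 'a set" where
  "EP_elements R star =
     {a \<in> group_invertibles R \<inter> MP_invertibles R star. group_inverse R a = MP_inverse R star a}"

lemma (in ring) group_inverse_unique:
  assumes a: "a \<in> carrier R" and x: "is_group_inverse R a x" and y: "is_group_inverse R a y"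
  shows "x = y"
proof -
  have c: "x \<in> carrier R" "y \<in> carrier R"
    and X: "a \<otimes> x \<otimes> a = a" "x \<otimes> a \<otimes> x = x" "a \<otimes> x = x \<otimes> a"
    and Y: "a \<otimes> y \<otimes> a = a" "y \<otimes> a \<otimes> y = y" "a \<otimes> y = y \<otimes> a"
    using x y by (auto simp: is_group_inverse_def)
  have "a \<otimes> x = (a \<otimes> y) \<otimes> (a \<otimes> x)" using Y(1) a c by (metis m_assoc m_closed)
  also have "\<dots> = (y \<otimes> a) \<otimes> (x \<otimes> a)" using X(3) Y(3) by simp
  also have "\<dots> = y \<otimes> (a \<otimes> x \<otimes> a)" using a c by (simp add: m_assoc)
  finally have e: "a \<otimes> x = a \<otimes> y" using X Y by simp
  have "x = x \<otimes> (a \<otimes> y)" using X(2) e a c by (metis m_assoc)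
  also have "\<dots> = y \<otimes> a \<otimes> y" using X(3) Y(3) e a c by (metis m_assoc)
  finally show ?thesis using Y by simp
qed

lemma (in star_ring) MP_inverse_unique:
  assumes a: "a \<in> carrier R" and x: "is_MP_inverse R star a x" and y: "is_MP_inverse R star a y"
  shows "x = y"
proof -
  have c: "x \<in> carrier R" "y \<in> carrier R"
    and X: "a \<otimes> x \<otimes> a = a" "x \<otimes> a \<otimes> x = x" "star (a \<otimes> x) = a \<otimes> x" "star (x \<otimes> a) = x \<otimes> a"
    and Y: "a \<otimes> y \<otimes> a = a" "y \<otimes> a \<otimes> y = y" "star (a \<otimes> y) = a \<otimes> y" "star (y \<otimes> a) = y \<otimes> a"
    using x y by (auto simp: is_MP_inverse_def)
  have "a \<otimes> x = (a \<otimes> y) \<otimes> (a \<otimes> x)" using Y(1) a c by (metis m_assoc m_closed)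
  then have "star (a \<otimes> x) = (a \<otimes> x) \<otimes> (a \<otimes> y)"
    using X(3) Y(3) a c by (metis star_mult m_closed)
  also have "\<dots> = a \<otimes> y" using X(1) a c by (metis m_assoc m_closed)
  finally have e: "a \<otimes> x = a \<otimes> y" using X(3) by simp
  have "x \<otimes> a = (x \<otimes> a) \<otimes> (y \<otimes> a)" using Y(1) a c by (metis m_assoc m_closed)
  then have "star (x \<otimes> a) = (y \<otimes> a) \<otimes> (x \<otimes> a)"
    using X(4) Y(4) a c by (metis star_mult m_closed)
  also have "\<dots> = y \<otimes> a" using X(1) a c by (metis m_assoc m_closed)
  finally have f: "x \<otimes> a = y \<otimes> a" using X(4) by simp
  show ?thesis using e f X(2) Y(2) a c by (metis m_assoc)
qed

end

theory Submission
  imports Defs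
begin

text \<open>
  In a \<open>*\<close>-reversible ring every idempotent is a central projection. If \<open>a b\<close> is EP with inverse
  \<open>x\<close>, then the idempotents \<open>p = a b x\<close> and \<open>b x a\<close> therefore coincide, so \<open>a p\<close> and \<open>b p\<close> are
  units of the corner ring \<open>p R\<close> with inverses \<open>b x\<close> and \<open>x a\<close>. As \<open>a b (1 - p) = 0\<close>,
  \<open>*\<close>-reversibility gives \<open>b* a = p b* a\<close>, which is thus a unit of \<open>p R\<close>, with inverse
  \<open>b x a* x*\<close>.

  Conversely, let \<open>a b = 0\<close>. As \<open>0\<close> is EP, the hypothesis makes \<open>c = b* a\<close> EP, and
  \<open>c* c = a* b b* a\<close>. Applying the hypothesis a second time, \<open>a* b* = (b a)*\<close> is EP with square
  zero, so \<open>b a = 0\<close>. Hence the ring is reversible: \<open>a b b* = 0\<close> gives \<open>b b* a = 0\<close>, so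
  \<open>c* c = 0\<close>, and a Moore-Penrose invertible \<open>c\<close> with \<open>c* c = 0\<close> vanishes.
\<close>

context star_ring
begin

lemma star_zero: "star \<zero> = \<zero>"
proof -
  have "star \<zero> \<oplus> star \<zero> = star \<zero>"
    using star_add[of \<zero> \<zero>] by simp
  then show ?thesis
    using star_closed[of \<zero>] by (metis add.r_cancel_one' zero_closed)
qed

lemma star_one: "star \<one> = \<one>"
  using star_mult[of "star \<one>" \<one>] star_closed[of \<one>] star_star[of \<one>] by simp

text \<open>Uniqueness of both inverses identifies each \<open>THE\<close> with its witness, so
  being EP amounts to having one common inverse \<open>x\<close>. Since \<open>a\<close> and
  \<open>x\<close> commute, self-adjointness of \<open>a x\<close> also covers that of
  \<open>x a\<close>.\<close>

lemma mem_EP_iff: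
  assumes a: "a \<in> carrier R"
  shows "a \<in> EP_elements R star \<longleftrightarrow>
    (\<exists>x\<in>carrier R. a \<otimes> x \<otimes> a = a \<and> x \<otimes> a \<otimes> x = x \<and> a \<otimes> x = x \<otimes> a \<and> star (a \<otimes> x) = a \<otimes> x)"
    (is "_ \<longleftrightarrow> ?R")
proof
  assume "a \<in> EP_elements R star"
  then obtain x y where x: "is_group_inverse R a x" and y: "is_MP_inverse R star a y"
    and e: "group_inverse R a = MP_inverse R star a"
    by (auto simp: EP_elements_def group_invertibles_def MP_invertibles_def)
  have "group_inverse R a = x"
    unfolding group_inverse_def using x group_inverse_unique[OF a] by blast
  moreover have "MP_inverse R star a = y"
    unfolding MP_inverse_def using y MP_inverse_unique[OF a] by blast
  ultimately have "x = y" using e by simp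
  then show ?R using x y by (auto simp: is_group_inverse_def is_MP_inverse_def)
next
  assume ?R
  then obtain x where x: "is_group_inverse R a x" and y: "is_MP_inverse R star a x"
    unfolding is_group_inverse_def is_MP_inverse_def by metis
  have "group_inverse R a = x"
    unfolding group_inverse_def using x group_inverse_unique[OF a] by blast
  moreover have "MP_inverse R star a = x"
    unfolding MP_inverse_def using y MP_inverse_unique[OF a] by blast
  ultimately show "a \<in> EP_elements R star"
    using a x y by (auto simp: EP_elements_def group_invertibles_def MP_invertibles_def)
qed

lemma zero_EP: "\<zero> \<in> EP_elements R star"
  by (auto simp: mem_EP_iff star_zero)

text \<open>Commuting turns \<open>a = a x a\<close> into \<open>a = x (a a)\<close>.\<close>

lemma EP_square_zero:
  assumes "a \<in> carrier R" "a \<in> EP_elements R star" "a \<otimes> a = \<zero>"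
  shows "a = \<zero>"
proof -
  obtain x where x: "x \<in> carrier R" "a \<otimes> x \<otimes> a = a" "a \<otimes> x = x \<otimes> a"
    using assms mem_EP_iff by blast
  have "a = x \<otimes> (a \<otimes> a)" using x assms(1) by (metis m_assoc)
  then show ?thesis using assms(3) x(1) by simp
qed

text \<open>Replacing \<open>a x\<close> by its adjoint \<open>x* a*\<close> in
  \<open>a = a x a\<close> exposes the factor \<open>a* a\<close>.\<close>

lemma EP_star_mult_self_zero:
  assumes a: "a \<in> carrier R" and "a \<in> EP_elements R star" "star a \<otimes> a = \<zero>"
  shows "a = \<zero>"
proof -
  obtain x where x: "x \<in> carrier R" "a \<otimes> x \<otimes> a = a" "star (a \<otimes> x) = a \<otimes> x"
    using assms mem_EP_iff by blast
  have "a = star x \<otimes> (star a \<otimes> a)"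
    using x a by (metis m_assoc star_mult star_closed)
  then show ?thesis using assms(3) x(1) by (simp add: star_closed)
qed

text \<open>Two applications of star-reversibility lead from \<open>a b = 0\<close> through
  \<open>b* a = 0\<close> to \<open>a* b* = 0\<close>, the adjoint of the claim.\<close>

lemma star_reversible_commute_zero:
  assumes "star_reversible R star" "a \<in> carrier R" "b \<in> carrier R" "a \<otimes> b = \<zero>"
  shows "b \<otimes> a = \<zero>"
proof -
  have "star b \<otimes> a = \<zero>" using assms by (auto simp: star_reversible_def)
  then have "star a \<otimes> star b = \<zero>"
    using assms by (auto simp: star_reversible_def star_closed)
  then have "star (b \<otimes> a) = \<zero>" using assms by (simp add: star_mult)
  then show ?thesis using assms star_star[of "b \<otimes> a"] by (simp add: star_zero)
qed

text \<open>From \<open>e (1 - e) = 0\<close> follows \<open>(1 - e)* e = 0\<close>, hence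
  \<open>e = e* e\<close>, and the right side is its own adjoint.\<close>

lemma star_reversible_idempotent_selfadjoint:
  assumes r: "star_reversible R star" and e: "e \<in> carrier R" "e \<otimes> e = e"
  shows "star e = e"
proof -
  have "e \<otimes> (\<one> \<ominus> e) = \<zero>"
    using e by (simp add: minus_eq r_distr r_minus r_neg)
  then have z: "star (\<one> \<ominus> e) \<otimes> e = \<zero>"
    using r e by (auto simp: star_reversible_def)
  have "(\<one> \<ominus> e) \<oplus> e = \<one>" using e by algebra
  then have "star (\<one> \<ominus> e) \<oplus> star e = \<one>"
    using star_add[of "\<one> \<ominus> e" e] e by (simp add: star_one)
  then have "e = (star (\<one> \<ominus> e) \<oplus> star e) \<otimes> e" using e by simp
  also have "\<dots> = star e \<otimes> e" using z e by (simp add: l_distr star_closed)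
  finally have "e = star e \<otimes> e" .
  then show ?thesis using e by (metis star_mult star_star star_closed)
qed

text \<open>The products \<open>e (s - e s)\<close> and \<open>(s - s e) e\<close> vanish; reversing
  the factors in both gives \<open>s e = e s e = e s\<close>.\<close>

lemma star_reversible_idempotent_central:
  assumes r: "star_reversible R star" and e: "e \<in> carrier R" "e \<otimes> e = e" and s: "s \<in> carrier R"
  shows "e \<otimes> s = s \<otimes> e"
proof -
  have ee: "e \<otimes> (e \<otimes> s) = e \<otimes> s"
    using e s by (simp add: m_assoc[symmetric])
  have "e \<otimes> (s \<ominus> e \<otimes> s) = \<zero>"
    using e s ee by (simp add: minus_eq r_distr r_minus r_neg)
  then have "(s \<ominus> e \<otimes> s) \<otimes> e = \<zero>"
    by (rule star_reversible_commute_zero[OF r, rotated -1]) (use e s in auto)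
  then have 1: "s \<otimes> e = e \<otimes> s \<otimes> e"
    using e s by (simp add: minus_eq l_distr l_minus) (metis add.inv_closed m_closed minus_equality minus_minus)
  have "(s \<ominus> s \<otimes> e) \<otimes> e = \<zero>"
    using e s by (simp add: minus_eq l_distr l_minus r_neg m_assoc)
  then have "e \<otimes> (s \<ominus> s \<otimes> e) = \<zero>"
    by (rule star_reversible_commute_zero[OF r, rotated -1]) (use e s in auto)
  then have 2: "e \<otimes> s = e \<otimes> s \<otimes> e"
    using e s by (simp add: minus_eq r_distr r_minus m_assoc) (metis add.inv_closed m_closed minus_equality minus_minus)
  show ?thesis using 1 2 by simp
qed

lemma star_reversible_EP:
  assumes r: "star_reversible R star" and a: "a \<in> carrier R" and b: "b \<in> carrier R"
    and ab: "a \<otimes> b \<in> EP_elements R star"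
  shows "star b \<otimes> a \<in> EP_elements R star"
proof -
  obtain x where x: "x \<in> carrier R" and X: "a \<otimes> b \<otimes> x \<otimes> (a \<otimes> b) = a \<otimes> b"
    "x \<otimes> (a \<otimes> b) \<otimes> x = x" "a \<otimes> b \<otimes> x = x \<otimes> (a \<otimes> b)"
    using ab a b mem_EP_iff by (meson m_closed)
  define p where "p = a \<otimes> b \<otimes> x"
  define f where "f = b \<otimes> x \<otimes> a"
  note cl = a b x star_closed[OF a] star_closed[OF b] star_closed[OF x]
  have p: "p \<in> carrier R" and f: "f \<in> carrier R" using cl by (auto simp: p_def f_def)
  have xab: "x \<otimes> a \<otimes> b = p" using X(3) cl by (simp add: p_def m_assoc)
  have px: "p \<otimes> x = x" using xab X(2) cl by (simp add: m_assoc)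
  have pab: "p \<otimes> (a \<otimes> b) = a \<otimes> b" using X(1) by (simp add: p_def)
  have pp: "p \<otimes> p = p"
    using pab cl p by (metis p_def m_assoc m_closed)
  have "f \<otimes> f = b \<otimes> (x \<otimes> (a \<otimes> b) \<otimes> x) \<otimes> a" using cl by (simp add: f_def m_assoc)
  then have ff: "f \<otimes> f = f" using X(2) by (simp add: f_def)
  have pc: "p \<otimes> s = s \<otimes> p" if "s \<in> carrier R" for s
    using star_reversible_idempotent_central[OF r p pp that] .
  have fc: "f \<otimes> s = s \<otimes> f" if "s \<in> carrier R" for s
    using star_reversible_idempotent_central[OF r f ff that] .
  have sp: "star p = p" using star_reversible_idempotent_selfadjoint[OF r p pp] .
  have "p \<otimes> f = b \<otimes> (p \<otimes> x) \<otimes> a"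
    using pc[OF b] cl p by (simp add: f_def m_assoc[symmetric])
  then have 1: "p \<otimes> f = f" using px by (simp add: f_def)
  \<comment> \<open>Regrouping \<open>p p\<close> as \<open>a (b x a) (b x)\<close> makes
    \<open>f\<close> appear in the middle, and centrality of \<open>f\<close> pulls it to the front,
    leaving \<open>f p\<close>.\<close>
  have "p = p \<otimes> p" using pp by simp
  also have "\<dots> = a \<otimes> f \<otimes> (b \<otimes> x)" using cl by (simp add: p_def f_def m_assoc)
  also have "\<dots> = f \<otimes> p" using fc[OF a] cl f by (simp add: p_def m_assoc[symmetric])
  finally have fp: "f = p" using 1 pc[OF f] by simp
  define c where "c = star b \<otimes> a"
  \<comment> \<open>In the corner \<open>p R\<close>, \<open>b x\<close> inverts \<open>a p\<close>,
    and \<open>a* x*\<close>, the adjoint of \<open>x a\<close>, inverts \<open>b* p\<close>; the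
    candidate inverse of \<open>c\<close> is their product in reverse order.\<close>
  define y where "y = b \<otimes> x \<otimes> (star a \<otimes> star x)"
  have c: "c \<in> carrier R" and y: "y \<in> carrier R" using cl by (auto simp: c_def y_def)
  \<comment> \<open>Split \<open>b\<close> as \<open>b (1 - p) + b p\<close>: the first summand
    contributes zero to \<open>c\<close>, the second contributes \<open>p b* a\<close>.\<close>
  have pc': "p \<otimes> c = c"
  proof -
    have "a \<otimes> (b \<otimes> (\<one> \<ominus> p)) = \<zero>"
    proof -
      have "a \<otimes> (b \<otimes> (\<one> \<ominus> p)) = a \<otimes> b \<ominus> a \<otimes> b \<otimes> p"
        using cl p by (simp add: m_assoc minus_eq r_distr r_minus)
      then show ?thesis using pab pc[of "a \<otimes> b"] cl by (simp add: minus_eq r_neg)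
    qed
    then have z: "star (b \<otimes> (\<one> \<ominus> p)) \<otimes> a = \<zero>"
      using r cl p by (auto simp: star_reversible_def)
    have "(\<one> \<ominus> p) \<oplus> p = \<one>" using p by algebra
    then have "b = b \<otimes> (\<one> \<ominus> p) \<oplus> b \<otimes> p"
      using r_distr[of "\<one> \<ominus> p" p b] cl p by simp
    then have "star b = star (b \<otimes> (\<one> \<ominus> p)) \<oplus> star (b \<otimes> p)"
      using star_add[of "b \<otimes> (\<one> \<ominus> p)" "b \<otimes> p"] cl p by simp
    then have "c = star (b \<otimes> (\<one> \<ominus> p)) \<otimes> a \<oplus> star (b \<otimes> p) \<otimes> a"
      using cl p by (simp add: c_def l_distr star_closed)
    also have "\<dots> = p \<otimes> c" using z cl p by (simp add: star_mult sp c_def m_assoc)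
    finally show ?thesis by simp
  qed
  have "c \<otimes> y = star b \<otimes> p \<otimes> (star a \<otimes> star x)"
    using cl by (simp add: c_def y_def p_def m_assoc)
  also have "\<dots> = p \<otimes> star (x \<otimes> a \<otimes> b)"
    using pc[of "star b"] cl p by (simp add: star_mult m_assoc[symmetric])
  finally have cy: "c \<otimes> y = p" using xab sp pp by simp
  \<comment> \<open>The inner factors \<open>a* x* b*\<close> form the adjoint of \<open>f\<close>,
    which equals \<open>p\<close>.\<close>
  have "y \<otimes> c = b \<otimes> x \<otimes> star f \<otimes> a"
    using cl by (simp add: c_def y_def f_def star_mult m_assoc)
  also have "\<dots> = b \<otimes> x \<otimes> p \<otimes> a" using fp sp by simp
  also have "\<dots> = p \<otimes> (b \<otimes> x) \<otimes> a" using pc[of "b \<otimes> x"] cl by simp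
  also have "\<dots> = p \<otimes> f" using cl p by (simp add: f_def m_assoc)
  finally have yc: "y \<otimes> c = p" using fp pp by simp
  have "p \<otimes> y = b \<otimes> (p \<otimes> x) \<otimes> (star a \<otimes> star x)"
    using pc[OF b] cl p by (simp add: y_def m_assoc[symmetric])
  then have py: "p \<otimes> y = y" using px by (simp add: y_def)
  have "c \<in> EP_elements R star"
    using mem_EP_iff[OF c] y cy yc pc' py sp by auto
  then show ?thesis by (simp add: c_def)
qed

lemma EP_imp_star_reversible:
  assumes H: "\<And>a b. a \<in> carrier R \<Longrightarrow> b \<in> carrier R \<Longrightarrow>
    a \<otimes> b \<in> EP_elements R star \<Longrightarrow> star b \<otimes> a \<in> EP_elements R star"
  shows "star_reversible R star"
proof -
  have rev: "b \<otimes> a = \<zero>" if a: "a \<in> carrier R" and b: "b \<in> carrier R" and z: "a \<otimes> b = \<zero>" for a b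
  proof -
    note cl = a b star_closed[OF a] star_closed[OF b]
    \<comment> \<open>The first use of \<open>H\<close> shows that \<open>b* a\<close> is EP; the
      second takes the pair \<open>b*\<close>, \<open>a\<close>.\<close>
    have "star a \<otimes> star b \<in> EP_elements R star"
      using H[OF cl(4) a] H[OF a b] z zero_EP by simp
    then have E: "star (b \<otimes> a) \<in> EP_elements R star" using cl by (simp add: star_mult)
    have "b \<otimes> a \<otimes> (b \<otimes> a) = b \<otimes> (a \<otimes> b) \<otimes> a" using cl by (simp add: m_assoc)
    then have "star (b \<otimes> a) \<otimes> star (b \<otimes> a) = \<zero>"
      using z cl star_mult[of "b \<otimes> a" "b \<otimes> a"] by (simp add: star_zero)
    then have "star (b \<otimes> a) = \<zero>" using EP_square_zero E cl star_closed by simp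
    then show ?thesis using star_star[of "b \<otimes> a"] cl by (simp add: star_zero)
  qed
  have "star b \<otimes> a = \<zero>"
    if a: "a \<in> carrier R" and b: "b \<in> carrier R" and z: "a \<otimes> b = \<zero>" for a b
  proof (rule EP_star_mult_self_zero)
    note cl = a b star_closed[OF a] star_closed[OF b]
    show "star b \<otimes> a \<in> carrier R" using cl by simp
    show "star b \<otimes> a \<in> EP_elements R star" using H[OF a b] z zero_EP by simp
    \<comment> \<open>Padding with \<open>b*\<close> lets \<open>rev\<close> carry \<open>a\<close>
      to the right end, which yields the tail \<open>b b* a\<close> of
      \<open>a* b b* a\<close>.\<close>
    have "a \<otimes> (b \<otimes> star b) = \<zero>" using z cl by (simp add: m_assoc[symmetric])
    then have "b \<otimes> star b \<otimes> a = \<zero>" using rev cl by simp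
    then show "star (star b \<otimes> a) \<otimes> (star b \<otimes> a) = \<zero>"
      using cl by (simp add: star_mult star_star m_assoc)
  qed
  then show ?thesis by (auto simp: star_reversible_def)
qed

end

theorem theorem4p7:
  fixes R :: "('a, 'm) ring_scheme" and star :: "'a \<Rightarrow> 'a"
  assumes "star_ring R star"
  shows "star_reversible R star \<longleftrightarrow>
    (\<forall>a\<in>carrier R. \<forall>b\<in>carrier R.
       a \<otimes>\<^bsub>R\<^esub> b \<in> EP_elements R star \<longrightarrow> star b \<otimes>\<^bsub>R\<^esub> a \<in> EP_elements R star)"
proof -
  interpret star_ring R star by fact
  show ?thesis using star_reversible_EP EP_imp_star_reversible by blast
qed

end
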